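(* Let $c=(0,c_2)\in\mathbb{N}^2$ with $c\neq 0$, and let $S_c=\{0\}\cup\{x\in\mathbb{N}^2\mid x\succeq_{glex}c\}$ be the ordinary $\mathbb{N}^2$-semigroup with conductor $c$, ordered by $\preceq_{glex}$. Then the minimal system of generators of $S_c$ is $$\{x\in\mathbb{N}^2\mid\pi(c)\leq\pi(x)\leq 2\pi(c)-1\},$$ and therefore its embedding dimension is $\mathrm{e}(S_c)=\dfrac{c_2(3c_2+1)}{2}$.
   Context: $\mathbb{N}$ contains $0$; for $x=(x_1,x_2)\in\mathbb{N}^2$, $\pi(x)=x_1+x_2$. The graded lexicographic order on $\mathbb{N}^2$ is: $x\prec_{glex}y$ iff $\pi(x)<\pi(y)$, or $\pi(x)=\pi(y)$ and $x_1<y_1$. The embedding dimension is the cardinality of the unique minimal system of generators. *)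

theory Defs
  imports Complex_Main "HOL-Library.Product_Plus"
begin

text \<open>Vectors of \<open>\<nat>\<^sup>2\<close> are pairs, with the componentwise addition and zero of
  \<^theory>\<open>HOL-Library.Product_Plus\<close>.\<close>

definition total_degree :: "nat \<times> nat \<Rightarrow> nat" where
  "total_degree x = fst x + snd x"

definition glex_less :: "nat \<times> nat \<Rightarrow> nat \<times> nat \<Rightarrow> bool" (infix "\<prec>\<^sub>g" 50) where
  "x \<prec>\<^sub>g y \<longleftrightarrow> total_degree x < total_degree y \<or>
     total_degree x = total_degree y \<and> fst x < fst y"

definition glex_le :: "nat \<times> nat \<Rightarrow> nat \<times> nat \<Rightarrow> bool" (infix "\<preceq>\<^sub>g" 50) where
  "x \<preceq>\<^sub>g y \<longleftrightarrow> x = y \<or> x \<prec>\<^sub>g y"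

definition ordinary_semigroup :: "nat \<times> nat \<Rightarrow> (nat \<times> nat) set" where
  "ordinary_semigroup c = {0} \<union> {x. c \<preceq>\<^sub>g x}"

text \<open>The submonoid generated by \<open>A\<close> consists of all finite sums, repetitions allowed, of
  elements of \<open>A\<close>; the empty sum contributes \<open>0\<close>.\<close>

definition generated_submonoid :: "'a::comm_monoid_add set \<Rightarrow> 'a set" where
  "generated_submonoid A = {sum_list xs | xs. set xs \<subseteq> A}"

definition minimal_generating_system :: "'a::comm_monoid_add set \<Rightarrow> 'a set \<Rightarrow> bool" where
  "minimal_generating_system S A \<longleftrightarrow>
     generated_submonoid A = S \<and> (\<forall>B. B \<subset> A \<longrightarrow> generated_submonoid B \<noteq> S)"

text \<open>Only meaningful when \<open>S\<close> has exactly one minimal system of generators.\<close>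

definition embedding_dimension :: "'a::comm_monoid_add set \<Rightarrow> nat" where
  "embedding_dimension S = card (THE A. minimal_generating_system S A)"

end

theory Submission
  imports Defs
begin

text \<open>Since \<open>c = (0, c\<^sub>2)\<close> is the \<open>glex\<close>-least vector of its degree, \<open>S\<^sub>c\<close> consists of \<open>0\<close> and
  all vectors of degree at least \<open>c\<^sub>2\<close>. A sum of two nonzero elements of \<open>S\<^sub>c\<close> has degree at least
  \<open>2 c\<^sub>2\<close>, so the vectors of degree between \<open>c\<^sub>2\<close> and \<open>2 c\<^sub>2 - 1\<close> lie in every generating system.
  Conversely, a vector of degree at least \<open>2 c\<^sub>2\<close> splits off a vector of degree exactly \<open>c\<^sub>2\<close>,
  leaving one of degree at least \<open>c\<^sub>2\<close>, so these vectors generate.\<close>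

lemma total_degree_add: "total_degree (x + y) = total_degree x + total_degree y"
  by (simp add: total_degree_def)

lemma total_degree_eq_0_iff: "total_degree x = 0 \<longleftrightarrow> x = 0"
  by (cases x) (simp add: total_degree_def zero_prod_def)

lemma ordinary_semigroup_axis:
  "ordinary_semigroup (0, n) = {0} \<union> {x. n \<le> total_degree x}"
  by (auto simp: ordinary_semigroup_def glex_le_def glex_less_def total_degree_def)

lemma generated_submonoid_0: "0 \<in> generated_submonoid A"
  unfolding generated_submonoid_def by (auto intro: exI[of _ "[]"])

lemma generated_submonoid_base: "a \<in> A \<Longrightarrow> a \<in> generated_submonoid A"
  unfolding generated_submonoid_def by (auto intro!: exI[of _ "[a]"])

lemma generated_submonoid_add:
  assumes "x \<in> generated_submonoid A" and "y \<in> generated_submonoid A"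
  shows "x + y \<in> generated_submonoid A"
proof -
  obtain xs ys where "x = sum_list xs" "set xs \<subseteq> A" "y = sum_list ys" "set ys \<subseteq> A"
    using assms by (auto simp: generated_submonoid_def)
  then show ?thesis
    unfolding generated_submonoid_def by (auto intro!: exI[of _ "xs @ ys"])
qed

text \<open>Adding a zero entry, or adding an entry to a zero sum, changes nothing essential; if
  both summands are nonzero, each has degree at least \<open>n\<close>. The middle alternative
  records that the sum is itself an entry, which is what makes low degrees indecomposable.\<close>

lemma sum_list_ordinary_semigroup_cases:
  assumes "set xs \<subseteq> {0} \<union> {x. n \<le> total_degree x}"
  shows "sum_list xs = 0 \<or> (sum_list xs \<in> set xs \<and> n \<le> total_degree (sum_list xs)) \<or>
    2 * n \<le> total_degree (sum_list xs)"
  using assms by (induction xs) (auto simp: total_degree_add)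

lemma generated_submonoid_subset_ordinary:
  assumes "A \<subseteq> {0} \<union> {x. n \<le> total_degree x}"
  shows "generated_submonoid A \<subseteq> {0} \<union> {x. n \<le> total_degree x}"
proof
  fix x assume "x \<in> generated_submonoid A"
  then obtain xs where "x = sum_list xs" "set xs \<subseteq> A"
    by (auto simp: generated_submonoid_def)
  with assms sum_list_ordinary_semigroup_cases[of xs n]
  show "x \<in> {0} \<union> {x. n \<le> total_degree x}"
    by auto
qed

lemma low_degrees_subset_generators:
  assumes "n > 0" and gen: "generated_submonoid A = {0} \<union> {x. n \<le> total_degree x}"
  shows "{x. n \<le> total_degree x \<and> total_degree x \<le> 2 * n - 1} \<subseteq> A"
proof
  fix x assume x: "x \<in> {x. n \<le> total_degree x \<and> total_degree x \<le> 2 * n - 1}"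
  with gen have "x \<in> generated_submonoid A" by simp
  then obtain xs where xs: "x = sum_list xs" "set xs \<subseteq> A"
    by (auto simp: generated_submonoid_def)
  have "A \<subseteq> {0} \<union> {x. n \<le> total_degree x}"
    using generated_submonoid_base gen by blast
  with xs have "set xs \<subseteq> {0} \<union> {x. n \<le> total_degree x}" by blast
  \<comment> \<open>The bounds \<open>n > 0\<close> and \<open>2 * n - 1\<close> on the degree of
    \<open>x\<close> exclude the first and third alternatives, so \<open>x\<close> is an entry of
    \<open>xs\<close>.\<close>
  from sum_list_ordinary_semigroup_cases[OF this] x xs \<open>n > 0\<close> show "x \<in> A"
    by (auto simp: total_degree_def)
qed

lemma split_total_degree:
  assumes "n \<le> total_degree x"
  obtains y z where "x = y + z" "total_degree y = n"
proof
  \<comment> \<open>Greedy choice: take as much of \<open>n\<close> as possible from the first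
    coordinate and the rest from the second, which is large enough because
    \<open>n \<le> total_degree x\<close>.\<close>
  let ?y = "(min n (fst x), n - min n (fst x))"
  let ?z = "(fst x - min n (fst x), snd x - (n - min n (fst x)))"
  show "x = ?y + ?z"
    using assms by (cases x) (auto simp: total_degree_def min_def)
  show "total_degree ?y = n"
    by (simp add: total_degree_def)
qed

lemma low_degrees_generate:
  assumes "n > 0"
  shows "generated_submonoid {x. n \<le> total_degree x \<and> total_degree x \<le> 2 * n - 1} =
    {0} \<union> {x. n \<le> total_degree x}"
    (is "generated_submonoid ?G = ?S")
proof
  show "generated_submonoid ?G \<subseteq> ?S"
    by (rule generated_submonoid_subset_ordinary) auto
  have "x \<in> generated_submonoid ?G" if "n \<le> total_degree x" for x
    using that
  proof (induction "total_degree x" arbitrary: x rule: less_induct)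
    case less
    show ?case
    proof (cases "total_degree x \<le> 2 * n - 1")
      case True
      then show ?thesis using less.prems by (intro generated_submonoid_base) simp
    next
      case False
      obtain y z where x: "x = y + z" and y: "total_degree y = n"
        using less.prems by (rule split_total_degree)
      \<comment> \<open>Here \<open>x\<close> has degree at least \<open>2 * n\<close>; removing
        \<open>y\<close> leaves at least \<open>n\<close>, and \<open>n > 0\<close> makes the degree
        drop, so induction applies to \<open>z\<close>.\<close>
      with False \<open>n > 0\<close> have "n \<le> total_degree z" "total_degree z < total_degree x"
        by (auto simp: total_degree_add)
      then have "z \<in> generated_submonoid ?G" by (intro less.hyps)
      moreover have "y \<in> generated_submonoid ?G"
        using y \<open>n > 0\<close> by (intro generated_submonoid_base) auto
      ultimately show ?thesis unfolding x by (intro generated_submonoid_add)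
    qed
  qed
  then show "?S \<subseteq> generated_submonoid ?G"
    using generated_submonoid_0 by auto
qed

text \<open>A least generating set \<open>G\<close> is a proper subset of any other generating set,
  which is therefore not minimal, while no proper subset of \<open>G\<close> can contain
  \<open>G\<close>.\<close>

lemma minimal_generating_system_unique:
  assumes "generated_submonoid G = S" and "\<And>A. generated_submonoid A = S \<Longrightarrow> G \<subseteq> A"
  shows "minimal_generating_system S A \<longleftrightarrow> A = G"
  using assms unfolding minimal_generating_system_def by blast

text \<open>Triangular numbers, doubled to avoid division. Finiteness is carried along because the
  cardinality of the disjoint union in the induction step requires it.\<close>

lemma card_total_degree_less:
  "finite {x. total_degree x < n} \<and> 2 * card {x. total_degree x < n} = n * (n + 1)"
proof (induction n)
  case 0
  show ?case by simp
next
  case (Suc n)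
  \<comment> \<open>The antidiagonal of degree \<open>n\<close>, parametrized by its first
    coordinate.\<close>
  let ?D = "(\<lambda>i. (i, n - i)) ` {..n}"
  have eq: "{x. total_degree x < Suc n} = {x. total_degree x < n} \<union> ?D"
    by (auto simp: total_degree_def image_iff)
  have "card ?D = Suc n"
    by (subst card_image) (auto simp: inj_on_def)
  moreover have "{x. total_degree x < n} \<inter> ?D = {}"
    by (auto simp: total_degree_def)
  ultimately have "card {x. total_degree x < Suc n} = card {x. total_degree x < n} + Suc n"
    unfolding eq using Suc by (subst card_Un_disjoint) auto
  with Suc show ?case by (simp add: eq)
qed

lemma card_low_degrees:
  assumes "n > 0"
  shows "real (card {x. n \<le> total_degree x \<and> total_degree x \<le> 2 * n - 1}) =
    real n * (3 * real n + 1) / 2"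
proof -
  let ?T = "\<lambda>m. {x. total_degree x < m}"
  \<comment> \<open>The band is a difference of two triangles. For \<open>n = 0\<close> truncated
    subtraction would leave the origin in the band but not in the difference.\<close>
  have "{x. n \<le> total_degree x \<and> total_degree x \<le> 2 * n - 1} = ?T (2 * n) - ?T n"
    using assms by auto
  moreover have sub: "?T n \<subseteq> ?T (2 * n)" by auto
  moreover have "card (?T n) \<le> card (?T (2 * n))"
    using card_total_degree_less sub by (intro card_mono) auto
  ultimately have "real (card {x. n \<le> total_degree x \<and> total_degree x \<le> 2 * n - 1}) =
      real (card (?T (2 * n))) - real (card (?T n))"
    using card_total_degree_less by (simp add: card_Diff_subset of_nat_diff)
  moreover have "2 * real (card (?T m)) = real m * (real m + 1)" for m
    using arg_cong[OF conjunct2[OF card_total_degree_less[of m]], of real] by (simp add: algebra_simps)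
  from this[of n] this[of "2 * n"]
  have "real (card (?T n)) = real n * (real n + 1) / 2"
    "real (card (?T (2 * n))) = 2 * real n * (2 * real n + 1) / 2"
    by simp_all
  ultimately show ?thesis by (simp add: field_simps)
qed

theorem proposition29:
  fixes c :: "nat \<times> nat" and c\<^sub>2 :: nat
  assumes "c = (0, c\<^sub>2)" and "c \<noteq> 0"
  shows "(\<forall>A. minimal_generating_system (ordinary_semigroup c) A \<longleftrightarrow>
            A = {x. total_degree c \<le> total_degree x \<and> total_degree x \<le> 2 * total_degree c - 1}) \<and>
         real (embedding_dimension (ordinary_semigroup c)) = real c\<^sub>2 * (3 * real c\<^sub>2 + 1) / 2"
proof -
  let ?G = "{x. total_degree c \<le> total_degree x \<and> total_degree x \<le> 2 * total_degree c - 1}"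
  have deg: "total_degree c = c\<^sub>2"
    using assms(1) by (simp add: total_degree_def)
  have pos: "c\<^sub>2 > 0"
    using assms(2) deg total_degree_eq_0_iff[of c] by simp
  have S: "ordinary_semigroup c = {0} \<union> {x. c\<^sub>2 \<le> total_degree x}"
    unfolding assms(1) by (rule ordinary_semigroup_axis)
  have min: "minimal_generating_system (ordinary_semigroup c) A \<longleftrightarrow> A = ?G" for A
    unfolding S deg
    by (intro minimal_generating_system_unique low_degrees_generate[OF pos]
        low_degrees_subset_generators[OF pos])
  \<comment> \<open>By \<open>min\<close> the description inside \<open>THE\<close> becomes
    \<open>A = ?G\<close>, so it denotes \<open>?G\<close>.\<close>
  moreover have "embedding_dimension (ordinary_semigroup c) = card ?G"
    unfolding embedding_dimension_def min by simp
  ultimately show ?thesis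
    using card_low_degrees[OF pos] deg by simp
qed

end
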